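(* Let $K(x,y)=\Phi(x-y)$, $x,y\in\mathbb{R}$, be a positive-definite kernel on $\mathbb{R}$. Suppose that (i) the function $\Phi\colon\mathbb{R}\to\mathbb{R}$ is integrable and infinitely differentiable in a neighbourhood of the origin; (ii) $\Phi^{(k)}(0)=0$ for every odd $k$; and (iii) the Fourier transform of $\Phi$ is everywhere positive. Let $n\ge1$, let $X=\{x_1,\dots,x_n\}\subset\mathbb{R}$ be distinct points, $m\colon\mathbb{R}\to\mathbb{R}$ a function, $Y=(y_1,\dots,y_n)\in\mathbb{R}^n$ and $Y_m=(y_i-m(x_i))_{i=1}^n$. For $\lambda>0$ let $K_\lambda(x,y)=\Phi((x-y)/\lambda)$ and $$\ell(\lambda\mid Y)=Y_m^{\mathsf T}K_\lambda(X,X)^{-1}Y_m+\log\det K_\lambda(X,X),\qquad\lambda_{\mathrm{ML}}\in\arg\min_{\lambda>0}\ell(\lambda\mid Y).$$ If $Y$ is $m$-constant, i.e. $Y_m=(c,\dots,c)$ for some $c\in\mathbb{R}$, then $$\lim_{\lambda\to\infty}\ell(\lambda\mid Y)=-\infty\quad\text{and}\quad\lambda_{\mathrm{ML}}=\infty.$$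
   Context: A kernel is a symmetric function; it is (strictly) positive-definite if $\sum_{i,j}a_ia_jK(z_i,z_j)>0$ for all $N\in\mathbb{N}$, all non-zero $a\in\mathbb{R}^N$ and all distinct $z_1,\dots,z_N$. $K_\lambda(X,X)=(K_\lambda(x_i,x_j))_{i,j=1}^n$. The Fourier transform is $\widehat f(\xi)=\int_{\mathbb{R}}f(x)e^{-\mathrm{i}\xi x}\,dx$. The statement $\lambda_{\mathrm{ML}}=\infty$ means that the infimum of $\ell(\lambda\mid Y)$ over $\lambda>0$ is approached only as $\lambda\to\infty$.
   Formalization: The formal theorem requires n ≥ 2 instead of n ≥ 1: for n = 1 the matrix K_λ(X,X) is (Φ(0)) for every λ, so ℓ(λ|Y) = c²/Φ(0) + log Φ(0) is constant and both conclusions fail. *)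

theory Defs
  imports "HOL-Analysis.Analysis"
begin

definition symmetric_kernel :: "('a \<Rightarrow> 'a \<Rightarrow> real) \<Rightarrow> bool" where
  "symmetric_kernel K \<longleftrightarrow> (\<forall>x y. K x y = K y x)"

definition positive_definite :: "('a \<Rightarrow> 'a \<Rightarrow> real) \<Rightarrow> bool" where
  "positive_definite K \<longleftrightarrow>
     (\<forall>(N::nat) (a :: nat \<Rightarrow> real) (z :: nat \<Rightarrow> 'a).
        inj_on z {..<N} \<longrightarrow> (\<exists>i<N. a i \<noteq> 0) \<longrightarrow>
        (\<Sum>i<N. \<Sum>j<N. a i * a j * K (z i) (z j)) > 0)"

definition infinitely_differentiable_near :: "(real \<Rightarrow> real) \<Rightarrow> real \<Rightarrow> bool" where
  "infinitely_differentiable_near f p \<longleftrightarrow>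
     (\<exists>U. open U \<and> p \<in> U \<and> (\<forall>k. \<forall>x\<in>U. (deriv ^^ k) f field_differentiable at x))"

definition fourier_transform :: "(real \<Rightarrow> real) \<Rightarrow> real \<Rightarrow> complex" where
  "fourier_transform f \<xi> =
     (LINT x|lebesgue. complex_of_real (f x) * exp (- (\<i> * complex_of_real \<xi> * complex_of_real x)))"

definition scaled_kernel :: "(real \<Rightarrow> real) \<Rightarrow> real \<Rightarrow> real \<Rightarrow> real \<Rightarrow> real" where
  "scaled_kernel \<Phi> l x y = \<Phi> ((x - y) / l)"

definition kernel_matrix :: "('a \<Rightarrow> 'a \<Rightarrow> real) \<Rightarrow> 'a ^ 'n \<Rightarrow> real ^ 'n ^ 'n" where
  "kernel_matrix K X = (\<chi> i j. K (X $ i) (X $ j))"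

definition residual :: "('a \<Rightarrow> real) \<Rightarrow> 'a ^ 'n \<Rightarrow> real ^ 'n \<Rightarrow> real ^ 'n" where
  "residual m X Y = (\<chi> i. Y $ i - m (X $ i))"

definition mean_constant :: "('a \<Rightarrow> real) \<Rightarrow> 'a ^ 'n \<Rightarrow> real ^ 'n \<Rightarrow> bool" where
  "mean_constant m X Y \<longleftrightarrow> (\<exists>c. residual m X Y = (\<chi> i. c))"

definition neg_log_likelihood ::
    "(real \<Rightarrow> real) \<Rightarrow> (real \<Rightarrow> real) \<Rightarrow> real ^ 'n \<Rightarrow> real ^ 'n \<Rightarrow> real \<Rightarrow> real" where
  "neg_log_likelihood \<Phi> m X Y l =
     residual m X Y \<bullet> (matrix_inv (kernel_matrix (scaled_kernel \<Phi> l) X) *v residual m X Y)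
       + ln (det (kernel_matrix (scaled_kernel \<Phi> l) X))"

text \<open>
  The infimum of \<open>f\<close> over the positive reals is approached only at infinity: every minimising
  sequence diverges to infinity. The infimum is taken in the extended reals, since it may be
  \<open>-\<infinity>\<close>. Minimising sequences always exist, so the condition is not vacuous, and a minimiser
  in the positive reals would yield a constant minimising sequence, so there is none.
\<close>

definition argmin_at_infinity :: "(real \<Rightarrow> real) \<Rightarrow> bool" where
  "argmin_at_infinity f \<longleftrightarrow>
     (\<forall>s :: nat \<Rightarrow> real. (\<forall>k. 0 < s k) \<longrightarrow>
        (\<lambda>k. ereal (f (s k))) \<longlonglongrightarrow> (INF l\<in>{0<..}. ereal (f l)) \<longrightarrow>
        filterlim s at_top sequentially)"

end

theory Submission
  imports Defs "HOL-Probability.Characteristic_Functions"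
begin

text \<open>
  Write \<open>M t\<close> for the matrix with entries \<open>\<Phi> (t * (x\<^sub>i - x\<^sub>j))\<close>, so that \<open>t = 1 / \<lambda>\<close> is the
  inverse length scale. The likelihood is the sum of the quadratic term
  \<open>c\<^sup>2 * (1\<^sup>T (M t)\<^sup>-\<^sup>1 1)\<close> and of \<open>ln (det (M t))\<close>.

  As \<open>t\<close> tends to \<open>0\<close>, all entries of \<open>M t\<close> tend to \<open>\<Phi> 0\<close>. With at least two points the limit
  matrix is singular, so the logarithm tends to \<open>-\<infinity>\<close>. It remains to see that the quadratic term
  stays bounded even though the matrix degenerates. By duality this is an inequality
  \<open>a\<^sup>T (M t) a \<ge> C * (\<Sum>i. a\<^sub>i)\<^sup>2\<close> with \<open>C > 0\<close> independent of \<open>t\<close> and \<open>a\<close>. On the Fourier side,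
  \<open>a\<^sup>T (M t) a\<close> is, up to a constant, the integral of the transform of \<open>\<Phi>\<close> against
  \<open>\<bar>p w\<bar>\<^sup>2\<close>, where \<open>p w = (\<Sum>j. a\<^sub>j exp (\<i> t x\<^sub>j w))\<close>. The transform is continuous and
  positive, hence bounded away from \<open>0\<close> on \<open>[0, 1]\<close>, and the claim becomes an inequality of Turan
  type: \<open>\<bar>p 0\<bar>\<^sup>2\<close> is at most a constant times the integral of \<open>\<bar>p\<bar>\<^sup>2\<close> over \<open>[0, 1]\<close>, where
  the constant depends on the number of frequencies only and not on their position. This uniformity
  in the frequencies is what gives uniformity in \<open>\<lambda>\<close>. The two halves are
  \<open>sum_squared_le_integral_expsum\<close> and \<open>quadratic_form_ge_integral_expsum\<close>, combined in
  \<open>quadratic_form_ge_sum_squared\<close>.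

  For the statement on minimising sequences, the likelihood must be bounded below on every interval
  \<open>(0, L]\<close>. The quadratic term is nonnegative, so only the determinant matters; it is continuous and
  positive, and it tends to \<open>\<Phi> 0 ^ n > 0\<close> as \<open>\<lambda>\<close> tends to \<open>0\<close>, because \<open>\<Phi>\<close> vanishes at infinity:
  a positive-definite function that is continuous at \<open>0\<close> is uniformly continuous, and an integrable
  uniformly continuous function decays.
\<close>

section \<open>A Turan inequality for exponential sums\<close>

definition expsum :: "'j set \<Rightarrow> ('j \<Rightarrow> real) \<Rightarrow> ('j \<Rightarrow> real) \<Rightarrow> real \<Rightarrow> complex" where
  "expsum J a u w = (\<Sum>j\<in>J. of_real (a j) * cis (u j * w))"

lemma expsum_0: "expsum J a u 0 = of_real (sum a J)"
  by (simp add: expsum_def)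

lemma continuous_on_expsum [continuous_intros]:
  "continuous_on S g \<Longrightarrow> continuous_on S (\<lambda>w. expsum J a u (g w))"
  unfolding expsum_def by (intro continuous_intros)

lemma borel_measurable_expsum [measurable]: "expsum J a u \<in> borel_measurable borel"
  by (intro borel_measurable_continuous_onI continuous_intros)

lemma norm_expsum_squared:
  "(norm (expsum J a u w))\<^sup>2 = (\<Sum>i\<in>J. \<Sum>j\<in>J. a i * a j * cos (w * (u i - u j)))"
proof -
  have "complex_of_real ((norm (expsum J a u w))\<^sup>2) = expsum J a u w * cnj (expsum J a u w)"
    by (rule complex_norm_square)
  also have "\<dots> = (\<Sum>i\<in>J. \<Sum>j\<in>J. of_real (a i * a j) * cis (w * (u i - u j)))"
    by (simp add: expsum_def sum_product cis_cnj cis_mult algebra_simps)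
  finally have "(norm (expsum J a u w))\<^sup>2
      = Re (\<Sum>i\<in>J. \<Sum>j\<in>J. of_real (a i * a j) * cis (w * (u i - u j)))"
    by (metis Re_complex_of_real)
  then show ?thesis by (simp add: Re_sum)
qed

text \<open>
  The sequence \<open>k \<mapsto> p (k * h)\<close> is a combination of powers of the numbers
  \<open>z\<^sub>j = exp (\<i> u\<^sub>j h)\<close>, so it is annihilated by the polynomial \<open>\<Prod>i. 1 - z / z\<^sub>i\<close>. The product is
  expanded over subsets because each of the resulting coefficients has modulus \<open>1\<close>.
\<close>

lemma expsum_recurrence:
  fixes J :: "'j set"
  assumes "finite J"
  shows "(\<Sum>S\<in>Pow J. (\<Prod>i\<in>S. - cis (- (u i * h))) * expsum J a u (real (card S) * h)) = 0"
proof -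
  have fin: "finite S" if "S \<in> Pow J" for S
    using that assms finite_subset by auto
  have "(\<Sum>S\<in>Pow J. (\<Prod>i\<in>S. - cis (- (u i * h))) * expsum J a u (real (card S) * h))
      = (\<Sum>S\<in>Pow J. \<Sum>j\<in>J. of_real (a j) * (\<Prod>i\<in>S. - cis (- (u i * h)) * cis (u j * h)))"
  proof (rule sum.cong[OF refl])
    fix S :: "'j set"
    have "cis (u j * h) ^ card S = cis (u j * (real (card S) * h))" for j
      unfolding Complex.DeMoivre by (rule arg_cong[where f = cis]) simp
    then show "(\<Prod>i\<in>S. - cis (- (u i * h))) * expsum J a u (real (card S) * h)
        = (\<Sum>j\<in>J. of_real (a j) * (\<Prod>i\<in>S. - cis (- (u i * h)) * cis (u j * h)))"
      by (simp only: expsum_def sum_distrib_left prod.distrib prod_constant ac_simps)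
  qed
  also have "\<dots> = (\<Sum>j\<in>J. of_real (a j) * (\<Sum>S\<in>Pow J. \<Prod>i\<in>S. - cis (- (u i * h)) * cis (u j * h)))"
    by (subst sum.swap) (simp add: sum_distrib_left)
  also have "\<dots> = (\<Sum>j\<in>J. of_real (a j) * (\<Prod>i\<in>J. - cis (- (u i * h)) * cis (u j * h) + 1))"
    by (simp only: prod_add[OF assms] prod.neutral_const mult_1_right)
  also have "\<dots> = 0"
  proof (rule sum.neutral, rule ballI)
    fix j assume "j \<in> J"
    moreover have "- cis (- (u j * h)) * cis (u j * h) + 1 = 0" by (simp add: cis_mult)
    ultimately have "(\<Prod>i\<in>J. - cis (- (u i * h)) * cis (u j * h) + 1) = 0"
      using assms by (intro prod_zero) auto
    then show "of_real (a j) * (\<Prod>i\<in>J. - cis (- (u i * h)) * cis (u j * h) + 1) = 0"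
      by (metis mult_zero_right)
  qed
  finally show ?thesis .
qed

lemma card_nonempty_subsets_le:
  assumes "finite J"
  shows "real (card (Pow J - {{}})) \<le> 2 ^ card J"
proof -
  have "card (Pow J - {{}}) \<le> 2 ^ card J"
    using card_mono[of "Pow J" "Pow J - {{}}"] assms by (simp add: card_Pow)
  then show ?thesis by (metis of_nat_le_iff of_nat_numeral of_nat_power)
qed

text \<open>
  The empty subset contributes \<open>p 0\<close> to the recurrence, which therefore expresses \<open>p 0\<close> through
  samples of \<open>p\<close> at the points \<open>k * h\<close> with \<open>1 \<le> k \<le> n\<close>, with coefficients bounded independently of
  the frequencies and of the step \<open>h\<close>.
\<close>

lemma sum_squared_le_expsum_samples:
  assumes "finite J"
  shows "(sum a J)\<^sup>2 \<le> 2 ^ card J * (\<Sum>S\<in>Pow J - {{}}. (norm (expsum J a u (real (card S) * h)))\<^sup>2)"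
proof -
  let ?A = "Pow J - {{}}"
  let ?w = "\<lambda>S. \<Prod>i\<in>S. - cis (- (u i * h))"
  have "expsum J a u 0 + (\<Sum>S\<in>?A. ?w S * expsum J a u (real (card S) * h)) = 0"
  proof -
    have "{} \<in> Pow J" by simp
    from sum.remove[OF finite_Pow_iff[THEN iffD2, OF assms] this, of "\<lambda>S. ?w S * expsum J a u (real (card S) * h)"]
    show ?thesis
      unfolding expsum_recurrence[OF assms] by (simp only: prod.empty card.empty of_nat_0 mult_zero_left mult_1_left)
  qed
  then have "expsum J a u 0 = - (\<Sum>S\<in>?A. ?w S * expsum J a u (real (card S) * h))"
    by (rule eq_neg_iff_add_eq_0[THEN iffD2])
  then have "norm (expsum J a u 0) = norm (\<Sum>S\<in>?A. ?w S * expsum J a u (real (card S) * h))"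
    by (simp only: norm_minus_cancel)
  also have "\<dots> \<le> (\<Sum>S\<in>?A. norm (expsum J a u (real (card S) * h)))"
    by (rule sum_norm_le) (simp add: norm_mult prod_norm [symmetric])
  finally have "\<bar>sum a J\<bar> \<le> (\<Sum>S\<in>?A. norm (expsum J a u (real (card S) * h)))"
    by (simp only: expsum_0 norm_of_real)
  then have "(sum a J)\<^sup>2 \<le> (\<Sum>S\<in>?A. norm (expsum J a u (real (card S) * h)))\<^sup>2"
    using power_mono[of "\<bar>sum a J\<bar>" _ 2] by simp
  also have "\<dots> \<le> card ?A * (\<Sum>S\<in>?A. (norm (expsum J a u (real (card S) * h)))\<^sup>2)"
    using sum_squared_le_sum_of_squares[of "\<lambda>S. norm (expsum J a u (real (card S) * h))" ?A]
    by (simp add: mult.commute)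
  also have "\<dots> \<le> 2 ^ card J * (\<Sum>S\<in>?A. (norm (expsum J a u (real (card S) * h)))\<^sup>2)"
  proof (rule mult_right_mono)
    show "real (card ?A) \<le> 2 ^ card J" by (rule card_nonempty_subsets_le[OF assms])
  qed (auto intro: sum_nonneg)
  finally show ?thesis .
qed

lemma integrable_indicator_expsum:
  "integrable lborel (\<lambda>w. indicator {l..r::real} w * (norm (expsum J a u (c * w)))\<^sup>2)"
  using borel_integrable_compact[of "{l..r}" "\<lambda>w. (norm (expsum J a u (c * w)))\<^sup>2"]
  by (simp add: continuous_intros)

text \<open>
  The sampled bound holds for every step \<open>h\<close>. Averaging it over \<open>h \<in> [0, 1 / n]\<close> keeps all sample
  points \<open>k * h\<close> inside \<open>[0, 1]\<close> and turns the samples into integrals.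
\<close>

lemma sum_squared_le_integral_expsum:
  assumes "finite J"
  shows "(sum a J)\<^sup>2 \<le> real (card J) * 4 ^ card J *
           (\<integral>w. indicator {0..1} w * (norm (expsum J a u w))\<^sup>2 \<partial>lborel)"
proof (cases "J = {}")
  case False
  let ?n = "card J" and ?f = "\<lambda>w. (norm (expsum J a u w))\<^sup>2" and ?A = "Pow J - {{}}"
  let ?I = "\<integral>w. indicator {0..1} w * ?f w \<partial>lborel"
  have n: "?n > 0" using assms False by (simp add: card_gt_0_iff)
  have stretch: "(\<integral>h. indicator {0..1 / ?n} h * ?f (k * h) \<partial>lborel) \<le> ?I"
    if k: "1 \<le> k" "k \<le> ?n" for k :: nat
  proof -
    have "real k * (\<integral>h. indicator {0..1 / ?n} h * ?f (k * h) \<partial>lborel)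
        = (\<integral>w. indicator {0..k / ?n} w * ?f w \<partial>lborel)"
      using k n
      by (subst (2) lborel_integral_real_affine[where t = 0 and c = "real k"])
         (auto simp: indicator_def field_simps zero_le_mult_iff
               intro!: arg_cong2[where f = "(*)"] Bochner_Integration.integral_cong)
    also have "\<dots> \<le> ?I"
    proof (rule integral_mono)
      show "integrable lborel (\<lambda>w. indicator {0..k / ?n} w * ?f w)"
        using integrable_indicator_expsum[of 0 "k / ?n" J a u 1] by simp
      show "integrable lborel (\<lambda>w. indicator {0..1} w * ?f w)"
        using integrable_indicator_expsum[of 0 1 J a u 1] by simp
      have "k / ?n \<le> 1" using k n by simp
      then show "indicator {0..k / ?n} w * ?f w \<le> indicator {0..1} w * ?f w" for w
        by (intro mult_right_mono) (auto simp: indicator_def)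
    qed
    also have "\<dots> \<le> real k * ?I"
    proof -
      have "0 \<le> ?I" by (intro integral_nonneg_AE) auto
      then show ?thesis using k mult_right_mono[of 1 "real k" ?I] by simp
    qed
    finally show ?thesis using k by simp
  qed
  have "(sum a J)\<^sup>2 / ?n = (\<integral>h. indicator {0..1 / ?n} h * (sum a J)\<^sup>2 \<partial>lborel)"
    by simp
  also have "\<dots> \<le> (\<integral>h. 2 ^ ?n * (\<Sum>S\<in>?A. indicator {0..1 / ?n} h * ?f (real (card S) * h)) \<partial>lborel)"
  proof (rule integral_mono)
    show "integrable lborel (\<lambda>h. indicator {0..1 / ?n} h * (sum a J)\<^sup>2)"
      by (intro integrable_mult_left integrable_real_indicator) auto
    show "integrable lborel (\<lambda>h. 2 ^ ?n * (\<Sum>S\<in>?A. indicator {0..1 / ?n} h * ?f (real (card S) * h)))"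
      by (intro integrable_mult_right Bochner_Integration.integrable_sum integrable_indicator_expsum)
    show "indicator {0..1 / ?n} h * (sum a J)\<^sup>2
        \<le> 2 ^ ?n * (\<Sum>S\<in>?A. indicator {0..1 / ?n} h * ?f (real (card S) * h))" for h
      using sum_squared_le_expsum_samples[OF assms, of a u h] by (auto simp: indicator_def)
  qed
  also have "\<dots> = 2 ^ ?n * (\<Sum>S\<in>?A. \<integral>h. indicator {0..1 / ?n} h * ?f (real (card S) * h) \<partial>lborel)"
    by (subst integral_mult_right_zero, subst Bochner_Integration.integral_sum)
       (auto intro: integrable_indicator_expsum)
  also have "\<dots> \<le> 2 ^ ?n * (\<Sum>S\<in>?A. ?I)"
  proof (intro mult_left_mono sum_mono stretch)
    fix S assume "S \<in> ?A"
    then show "1 \<le> card S" "card S \<le> ?n"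
      using assms by (auto simp: card_mono Suc_le_eq card_gt_0_iff intro: finite_subset)
  qed auto
  also have "\<dots> \<le> 2 ^ ?n * (2 ^ ?n * ?I)"
    using card_nonempty_subsets_le[OF assms]
    by (auto intro!: mult_right_mono integral_nonneg_AE)
  also have "\<dots> = 4 ^ ?n * ?I"
    using power_mult_distrib[of "2::real" 2 ?n] by simp
  finally show ?thesis using n by (simp add: field_simps)
qed simp

section \<open>Gaussian smoothing and Fourier inversion\<close>

lemma integral_cos_std_normal:
  "(\<integral>w. cos (t * w) \<partial>std_normal_distribution) = exp (- t\<^sup>2 / 2)"
proof -
  interpret real_distribution std_normal_distribution by (rule real_dist_normal_dist)
  have "(\<integral>w. cos (t * w) \<partial>std_normal_distribution)
      = (\<integral>w. Re (exp (\<i> * complex_of_real (t * w))) \<partial>std_normal_distribution)"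
    by (simp add: Re_exp)
  also have "\<dots> = Re (char std_normal_distribution t)"
    unfolding char_def by (rule integral_Re, rule integrable_iexp) auto
  finally show ?thesis by (simp add: char_std_normal_distribution)
qed

lemma integrable_mult_cos:
  fixes f :: "real \<Rightarrow> real"
  assumes "integrable lborel f"
  shows "integrable lborel (\<lambda>x. f x * cos (\<omega> * (x - d)))"
proof (rule Bochner_Integration.integrable_bound[OF assms])
  show "AE x in lborel. norm (f x * cos (\<omega> * (x - d))) \<le> norm (f x)"
    by (simp add: abs_mult mult_left_le)
qed (use assms in measurable)

lemma integrable_mult_sin:
  fixes f :: "real \<Rightarrow> real"
  assumes "integrable lborel f"
  shows "integrable lborel (\<lambda>x. f x * sin (\<omega> * x))"
proof (rule Bochner_Integration.integrable_bound[OF assms])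
  show "AE x in lborel. norm (f x * sin (\<omega> * x)) \<le> norm (f x)"
    by (simp add: abs_mult mult_left_le)
qed (use assms in measurable)

definition cosine_transform :: "(real \<Rightarrow> real) \<Rightarrow> real \<Rightarrow> real" where
  "cosine_transform f \<omega> = (\<integral>x. f x * cos (\<omega> * x) \<partial>lborel)"

text \<open>
  A real Fourier transform has no sine part. Then multiplication by \<open>cos (\<omega> * d)\<close> corresponds to
  translation by \<open>d\<close>, without the usual reflected term.
\<close>

lemma cosine_transform_mult_cos:
  assumes int: "integrable lborel f" and sin0: "(\<integral>x. f x * sin (\<omega> * x) \<partial>lborel) = 0"
  shows "cosine_transform f \<omega> * cos (\<omega> * d) = (\<integral>x. f x * cos (\<omega> * (x - d)) \<partial>lborel)"
proof -
  have "(\<integral>x. f x * cos (\<omega> * (x - d)) \<partial>lborel)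
      = (\<integral>x. f x * cos (\<omega> * x) * cos (\<omega> * d) + f x * sin (\<omega> * x) * sin (\<omega> * d) \<partial>lborel)"
    by (simp add: cos_diff algebra_simps)
  also have "\<dots> = cosine_transform f \<omega> * cos (\<omega> * d)"
    using integrable_mult_cos[OF int, of \<omega> 0] integrable_mult_sin[OF int, of \<omega>] sin0
    by (subst Bochner_Integration.integral_add) (auto simp: cosine_transform_def)
  finally show ?thesis by simp
qed

lemma abs_cosine_transform_le:
  assumes "integrable lborel f"
  shows "\<bar>cosine_transform f \<omega>\<bar> \<le> (\<integral>x. \<bar>f x\<bar> \<partial>lborel)"
  unfolding cosine_transform_def
proof (rule integral_abs_bound[THEN order_trans], rule integral_mono)
  show "integrable lborel (\<lambda>x. \<bar>f x * cos (\<omega> * x)\<bar>)"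
    using integrable_mult_cos[OF assms, of \<omega> 0] by simp
  show "integrable lborel (\<lambda>x. \<bar>f x\<bar>)" using assms by simp
qed (simp add: abs_mult mult_left_le)

lemma continuous_on_cosine_transform:
  assumes "integrable lborel f"
  shows "continuous_on UNIV (cosine_transform f)"
  unfolding continuous_on_sequentially
proof (clarsimp simp: comp_def)
  fix x :: "nat \<Rightarrow> real" and a
  assume "x \<longlonglongrightarrow> a"
  then show "(\<lambda>n. cosine_transform f (x n)) \<longlonglongrightarrow> cosine_transform f a"
    unfolding cosine_transform_def
    by (intro integral_dominated_convergence[where w = "\<lambda>x. \<bar>f x\<bar>"])
       (use assms in \<open>auto intro!: tendsto_intros AE_I2 simp: abs_mult mult_left_le\<close>)
qed

lemma fourier_transform_cos_sin:
  assumes int: "integrable lborel f"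
  shows "Re (fourier_transform f \<xi>) = cosine_transform f \<xi>"
    and "Im (fourier_transform f \<xi>) = - (\<integral>x. f x * sin (\<xi> * x) \<partial>lborel)"
proof -
  have [measurable]: "f \<in> borel_measurable borel" using int by auto
  let ?g = "\<lambda>x. complex_of_real (f x) * exp (- (\<i> * complex_of_real \<xi> * complex_of_real x))"
  have e: "exp (- (\<i> * complex_of_real \<xi> * complex_of_real x)) = cis (- (\<xi> * x))" for x
    by (simp add: cis_conv_exp mult_ac)
  have ft: "fourier_transform f \<xi> = (\<integral>x. ?g x \<partial>lborel)"
    unfolding fourier_transform_def by (rule integral_completion) measurable
  have "integrable lborel ?g"
  proof (rule Bochner_Integration.integrable_bound[OF int])
    show "AE x in lborel. norm (?g x) \<le> norm (f x)" by (simp add: e norm_mult)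
  qed measurable
  then show "Re (fourier_transform f \<xi>) = cosine_transform f \<xi>"
    and "Im (fourier_transform f \<xi>) = - (\<integral>x. f x * sin (\<xi> * x) \<partial>lborel)"
    unfolding ft cosine_transform_def
    by (simp_all add: e flip: integral_Re integral_Im Bochner_Integration.integral_minus)
qed

text \<open>
  Inserting the Gaussian factor makes the double integral absolutely convergent, so Fubini applies
  although the integrability of the transform itself is not known. The Gaussian on the frequency
  side becomes the law of \<open>z / s\<close> on the other side.
\<close>

lemma gaussian_smoothed_inversion:
  assumes int: "integrable lborel f"
    and sin0: "\<And>\<omega>. (\<integral>x. f x * sin (\<omega> * x) \<partial>lborel) = 0"
    and s: "s > 0"
  shows "(\<integral>z. f (d + z / s) \<partial>std_normal_distribution)
       = 1 / sqrt (2 * pi) *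
         (\<integral>\<omega>. std_normal_density (\<omega> / s) * (cosine_transform f \<omega> * cos (\<omega> * d)) \<partial>lborel)"
proof -
  let ?N = std_normal_distribution
  interpret N: real_distribution ?N by (rule real_dist_normal_dist)
  interpret P: pair_sigma_finite lborel ?N by unfold_locales
  have [measurable]: "f \<in> borel_measurable borel" using int by auto
  have cos_le: "\<bar>f x * cos (s * w * (x - d))\<bar> \<le> \<bar>f x\<bar>" for x w
    by (simp add: abs_mult mult_left_le)
  define H where "H \<omega> = (\<integral>x. f x * cos (\<omega> * (x - d)) \<partial>lborel)" for \<omega>
  have [measurable]: "H \<in> borel_measurable borel" unfolding H_def by measurable
  have H: "H \<omega> = cosine_transform f \<omega> * cos (\<omega> * d)" for \<omega>
    unfolding H_def using cosine_transform_mult_cos[OF int sin0] by simp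
  have "(\<integral>w. H (s * w) \<partial>?N) = (\<integral>x. (\<integral>w. f x * cos (s * w * (x - d)) \<partial>?N) \<partial>lborel)"
    unfolding H_def
  proof (rule P.Fubini_integral, rule P.Fubini_integrable)
    show "AE x in lborel. integrable ?N (\<lambda>w. case (x, w) of (x, w) \<Rightarrow> f x * cos (s * w * (x - d)))"
    proof (rule AE_I2)
      show "integrable ?N (\<lambda>w. case (x, w) of (x, w) \<Rightarrow> f x * cos (s * w * (x - d)))" for x
        unfolding prod.case
        by (rule N.integrable_const_bound[where B = "\<bar>f x\<bar>"]) (auto simp: cos_le simp del: abs_mult)
    qed
    show "integrable lborel (\<lambda>x. \<integral>w. norm (case (x, w) of (x, w) \<Rightarrow> f x * cos (s * w * (x - d))) \<partial>?N)"
    proof (rule Bochner_Integration.integrable_bound[OF int], measurable, intro AE_I2)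
      fix x
      have "\<bar>\<integral>w. \<bar>f x * cos (s * w * (x - d))\<bar> \<partial>?N\<bar> \<le> (\<integral>w. \<bar>f x\<bar> \<partial>?N)"
        by (rule integral_abs_bound[THEN order_trans], rule integral_mono)
           (auto intro!: N.integrable_const_bound[where B = "\<bar>f x\<bar>"] simp: cos_le)
      then show "norm (\<integral>w. norm (case (x, w) of (x, w) \<Rightarrow> f x * cos (s * w * (x - d))) \<partial>?N) \<le> norm (f x)"
        using N.prob_space by simp
    qed
  qed measurable
  also have "\<dots> = (\<integral>x. f x * exp (- (s * (x - d))\<^sup>2 / 2) \<partial>lborel)"
  proof (rule Bochner_Integration.integral_cong[OF refl])
    fix x
    have "(\<integral>w. cos (s * w * (x - d)) \<partial>?N) = exp (- (s * (x - d))\<^sup>2 / 2)"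
      using integral_cos_std_normal[of "s * (x - d)"] by (simp add: mult_ac)
    then show "(\<integral>w. f x * cos (s * w * (x - d)) \<partial>?N) = f x * exp (- (s * (x - d))\<^sup>2 / 2)"
      by simp
  qed
  also have "\<dots> = 1 / s * (\<integral>z. f (d + z / s) * exp (- z\<^sup>2 / 2) \<partial>lborel)"
    using s by (subst lborel_integral_real_affine[where c = "1 / s" and t = d]) auto
  also have "\<dots> = sqrt (2 * pi) / s * (\<integral>z. f (d + z / s) \<partial>?N)"
  proof -
    have "(\<integral>z. f (d + z / s) \<partial>?N)
        = (\<integral>z. 1 / sqrt (2 * pi) * (f (d + z / s) * exp (- z\<^sup>2 / 2)) \<partial>lborel)"
      by (simp add: integral_density std_normal_density_def mult_ac)
    also have "\<dots> = 1 / sqrt (2 * pi) * (\<integral>z. f (d + z / s) * exp (- z\<^sup>2 / 2) \<partial>lborel)"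
      by (rule integral_mult_right_zero)
    finally show ?thesis by simp
  qed
  finally have "(\<integral>z. f (d + z / s) \<partial>?N) = s / sqrt (2 * pi) * (\<integral>w. H (s * w) \<partial>?N)"
    using s by (simp add: field_simps)
  also have "(\<integral>w. H (s * w) \<partial>?N) = (\<integral>w. std_normal_density w * H (s * w) \<partial>lborel)"
    by (simp add: integral_density)
  also have "\<dots> = 1 / s * (\<integral>\<omega>. std_normal_density (\<omega> / s) * H \<omega> \<partial>lborel)"
    using s by (subst lborel_integral_real_affine[where c = "1 / s" and t = 0]) auto
  finally show ?thesis using s by (simp add: H)
qed

lemma gaussian_smoothing_tendsto:
  assumes cont: "continuous_on UNIV f" and bnd: "\<And>x. \<bar>f x\<bar> \<le> (B::real)"
  shows "(\<lambda>k. \<integral>z. f (d + z / real (Suc k)) \<partial>std_normal_distribution) \<longlonglongrightarrow> f d"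
proof -
  interpret real_distribution std_normal_distribution by (rule real_dist_normal_dist)
  have [measurable]: "f \<in> borel_measurable borel"
    using cont by (rule borel_measurable_continuous_onI)
  have "(\<lambda>k. \<integral>z. f (d + z / real (Suc k)) \<partial>std_normal_distribution)
      \<longlonglongrightarrow> (\<integral>z. f d \<partial>std_normal_distribution)"
  proof (rule integral_dominated_convergence[where w = "\<lambda>_. B"])
    show "AE z in std_normal_distribution. (\<lambda>k. f (d + z / real (Suc k))) \<longlonglongrightarrow> f d"
    proof (rule AE_I2)
      fix z
      have "(\<lambda>k. d + z * (1 / real (Suc k))) \<longlonglongrightarrow> d + z * 0"
        by (intro tendsto_intros LIMSEQ_Suc[OF lim_1_over_n])
      then show "(\<lambda>k. f (d + z / real (Suc k))) \<longlonglongrightarrow> f d"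
        using continuous_on_tendsto_compose[OF cont] by simp
    qed
  qed (use bnd in auto)
  then show ?thesis using prob_space by simp
qed

text \<open>
  The smoothed forms equal integrals of a nonnegative function of \<open>\<omega>\<close>, which are bounded below by
  their part over \<open>[0, 1]\<close>. This bound is the same for all smoothing parameters and passes to the
  limit, where the smoothing disappears.
\<close>

lemma quadratic_form_ge_integral_expsum:
  assumes cont: "continuous_on UNIV f" and bnd: "\<And>x. \<bar>f x\<bar> \<le> B"
    and int: "integrable lborel f"
    and sin0: "\<And>\<omega>. (\<integral>x. f x * sin (\<omega> * x) \<partial>lborel) = 0"
    and pos: "\<And>\<omega>. cosine_transform f \<omega> \<ge> 0"
    and \<delta>: "\<And>\<omega>. \<omega> \<in> {0..1} \<Longrightarrow> cosine_transform f \<omega> \<ge> \<delta>" "\<delta> \<ge> 0"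
    and "finite J"
  shows "\<delta> * std_normal_density 1 / sqrt (2 * pi) *
           (\<integral>w. indicator {0..1} w * (norm (expsum J a u w))\<^sup>2 \<partial>lborel)
         \<le> (\<Sum>i\<in>J. \<Sum>j\<in>J. a i * a j * f (u i - u j))"
proof (rule LIMSEQ_le_const)
  let ?F = "cosine_transform f" and ?\<phi> = std_normal_density
  let ?E = "\<lambda>k d. \<integral>z. f (d + z / real (Suc k)) \<partial>std_normal_distribution"
  let ?c = "1 / sqrt (2 * pi)"
  show "(\<lambda>k. \<Sum>i\<in>J. \<Sum>j\<in>J. a i * a j * ?E k (u i - u j))
      \<longlonglongrightarrow> (\<Sum>i\<in>J. \<Sum>j\<in>J. a i * a j * f (u i - u j))"
    by (intro tendsto_intros gaussian_smoothing_tendsto[OF cont bnd])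
  have meas [measurable]: "?F \<in> borel_measurable borel"
    using continuous_on_cosine_transform[OF int] by (rule borel_measurable_continuous_onI)
  have "\<delta> * ?\<phi> 1 / sqrt (2 * pi) * (\<integral>w. indicator {0..1} w * (norm (expsum J a u w))\<^sup>2 \<partial>lborel)
      \<le> (\<Sum>i\<in>J. \<Sum>j\<in>J. a i * a j * ?E k (u i - u j))" for k
  proof -
    let ?s = "real (Suc k)"
    have integrable_\<phi>: "integrable lborel (\<lambda>w. ?\<phi> (w / ?s))"
      using lborel_integrable_real_affine[OF integrable_normal_density, of 1 "1 / ?s" 0 0] by simp
    have term_integrable: "integrable lborel (\<lambda>w. ?\<phi> (w / ?s) * (?F w * cos (w * d)))" for d
    proof (rule Bochner_Integration.integrable_bound)
      let ?L = "\<integral>x. \<bar>f x\<bar> \<partial>lborel"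
      show "integrable lborel (\<lambda>w. ?L * ?\<phi> (w / ?s))"
        using integrable_\<phi> by simp
      have "\<bar>?F w * cos (w * d)\<bar> \<le> ?L" for w
        using mult_mono[OF abs_cosine_transform_le[OF int, of w] abs_cos_le_one[of "w * d"]]
        by (simp add: abs_mult)
      then have "\<bar>?F w * cos (w * d)\<bar> * ?\<phi> (w / ?s) \<le> \<bar>?L\<bar> * ?\<phi> (w / ?s)" for w
        by (intro mult_right_mono order_trans[OF _ abs_ge_self]) auto
      then show "AE w in lborel. norm (?\<phi> (w / ?s) * (?F w * cos (w * d))) \<le> norm (?L * ?\<phi> (w / ?s))"
        by (simp add: abs_mult mult_ac)
    qed measurable
    have sum_eq: "(\<Sum>i\<in>J. \<Sum>j\<in>J. a i * a j * (?\<phi> (w / ?s) * (?F w * cos (w * (u i - u j)))))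
        = ?\<phi> (w / ?s) * ?F w * (norm (expsum J a u w))\<^sup>2" for w
      by (simp add: norm_expsum_squared sum_distrib_left mult_ac)
    have "(\<Sum>i\<in>J. \<Sum>j\<in>J. a i * a j * ?E k (u i - u j))
        = ?c * (\<Sum>i\<in>J. \<Sum>j\<in>J. \<integral>w. a i * a j * (?\<phi> (w / ?s) * (?F w * cos (w * (u i - u j)))) \<partial>lborel)"
      by (simp add: gaussian_smoothed_inversion[OF int sin0] sum_distrib_left mult_ac del: of_nat_Suc)
    also have "\<dots> = ?c * (\<integral>w. (\<Sum>i\<in>J. \<Sum>j\<in>J. a i * a j * (?\<phi> (w / ?s) * (?F w * cos (w * (u i - u j))))) \<partial>lborel)"
      by (subst Bochner_Integration.integral_sum
          | intro Bochner_Integration.integrable_sum integrable_mult_right term_integrable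
          | simp only: refl)+
    also have "\<dots> = ?c * (\<integral>w. ?\<phi> (w / ?s) * ?F w * (norm (expsum J a u w))\<^sup>2 \<partial>lborel)"
      by (simp only: sum_eq)
    finally have eq: "(\<Sum>i\<in>J. \<Sum>j\<in>J. a i * a j * ?E k (u i - u j))
        = ?c * (\<integral>w. ?\<phi> (w / ?s) * ?F w * (norm (expsum J a u w))\<^sup>2 \<partial>lborel)" .
    have "\<delta> * ?\<phi> 1 * (\<integral>w. indicator {0..1} w * (norm (expsum J a u w))\<^sup>2 \<partial>lborel)
        = (\<integral>w. \<delta> * ?\<phi> 1 * (indicator {0..1} w * (norm (expsum J a u w))\<^sup>2) \<partial>lborel)"
      by simp
    also have "\<dots> \<le> (\<integral>w. ?\<phi> (w / ?s) * ?F w * (norm (expsum J a u w))\<^sup>2 \<partial>lborel)"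
    proof (rule integral_mono)
      show "integrable lborel (\<lambda>w. \<delta> * ?\<phi> 1 * (indicator {0..1} w * (norm (expsum J a u w))\<^sup>2))"
        using integrable_indicator_expsum[of 0 1 J a u 1] by simp
      show "integrable lborel (\<lambda>w. ?\<phi> (w / ?s) * ?F w * (norm (expsum J a u w))\<^sup>2)"
        unfolding sum_eq[symmetric]
        by (intro Bochner_Integration.integrable_sum integrable_mult_right term_integrable)
      show "\<delta> * ?\<phi> 1 * (indicator {0..1} w * (norm (expsum J a u w))\<^sup>2)
          \<le> ?\<phi> (w / ?s) * ?F w * (norm (expsum J a u w))\<^sup>2" for w
      proof (cases "w \<in> {0..1}")
        case True
        \<comment> \<open>As \<open>?s \<ge> 1\<close>, the density at \<open>w / ?s\<close> is at least its value at \<open>1\<close>.\<close>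
        have "w / ?s \<le> 1" "0 \<le> w / ?s" using True by (auto simp: divide_le_eq)
        then have "(w / ?s)\<^sup>2 \<le> 1" by (simp add: power_le_one del: of_nat_Suc)
        then have "?\<phi> 1 \<le> ?\<phi> (w / ?s)"
          by (simp add: std_normal_density_def divide_right_mono del: of_nat_Suc)
        with \<delta>(1)[OF True] \<delta>(2) have "\<delta> * ?\<phi> 1 \<le> ?F w * ?\<phi> (w / ?s)"
          by (intro mult_mono pos) auto
        from mult_right_mono[OF this, of "(norm (expsum J a u w))\<^sup>2"]
        show ?thesis using True by (simp add: mult_ac del: of_nat_Suc)
      qed (simp add: pos)
    qed
    finally show ?thesis unfolding eq
      using mult_left_mono[of _ _ ?c] by (simp add: field_simps)
  qed
  then show "\<exists>N. \<forall>k\<ge>N. \<delta> * ?\<phi> 1 / sqrt (2 * pi) *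
        (\<integral>w. indicator {0..1} w * (norm (expsum J a u w))\<^sup>2 \<partial>lborel)
      \<le> (\<Sum>i\<in>J. \<Sum>j\<in>J. a i * a j * ?E k (u i - u j))"
    by blast
qed

text \<open>
  The infimum of the transform over \<open>[0, 1]\<close> enters the constant. Since \<open>C\<close> is chosen before the
  nodes \<open>u\<close>, the bound is invariant under rescaling them.
\<close>

lemma quadratic_form_ge_sum_squared:
  assumes cont: "continuous_on UNIV f" and bnd: "\<And>x. \<bar>f x\<bar> \<le> B"
    and int: "integrable lborel f"
    and sin0: "\<And>\<omega>. (\<integral>x. f x * sin (\<omega> * x) \<partial>lborel) = 0"
    and pos: "\<And>\<omega>. cosine_transform f \<omega> > 0"
    and n: "0 < (n :: nat)"
  shows "\<exists>C>0. \<forall>J (a :: 'j \<Rightarrow> real) u. finite J \<longrightarrow> card J = n \<longrightarrow>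
           C * (sum a J)\<^sup>2 \<le> (\<Sum>i\<in>J. \<Sum>j\<in>J. a i * a j * f (u i - u j))"
proof -
  have "continuous_on {0..1} (cosine_transform f)"
    using continuous_on_cosine_transform[OF int] by (rule continuous_on_subset) simp
  then obtain w where w: "\<And>\<omega>. \<omega> \<in> {0..1} \<Longrightarrow> cosine_transform f w \<le> cosine_transform f \<omega>"
    using continuous_attains_inf[of "{0..1::real}" "cosine_transform f"] by fastforce
  define c where "c = cosine_transform f w * std_normal_density 1 / sqrt (2 * pi)"
  have c: "c > 0" unfolding c_def using pos by (simp add: normal_density_pos)
  have n4: "real n * 4 ^ n > 0" using n by simp
  show ?thesis
  proof (intro exI[of _ "c / (real n * 4 ^ n)"] conjI allI impI)
    show "c / (real n * 4 ^ n) > 0" using c n4 by simp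
    fix J :: "'j set" and a u :: "'j \<Rightarrow> real"
    assume J: "finite J" "card J = n"
    let ?I = "\<integral>w. indicator {0..1} w * (norm (expsum J a u w))\<^sup>2 \<partial>lborel"
    have "(sum a J)\<^sup>2 \<le> real n * 4 ^ n * ?I"
      using sum_squared_le_integral_expsum[OF J(1), of a u] unfolding J(2) .
    then have "c * (sum a J)\<^sup>2 \<le> c * (real n * 4 ^ n * ?I)"
      using c by (intro mult_left_mono) auto
    then have "c / (real n * 4 ^ n) * (sum a J)\<^sup>2 \<le> c * ?I"
      using n4 by (simp add: divide_le_eq mult_ac)
    also have "\<dots> \<le> (\<Sum>i\<in>J. \<Sum>j\<in>J. a i * a j * f (u i - u j))"
      unfolding c_def
      by (rule quadratic_form_ge_integral_expsum[OF cont bnd int sin0])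
         (use pos w J in \<open>auto intro: less_imp_le\<close>)
    finally show "c / (real n * 4 ^ n) * (sum a J)\<^sup>2
        \<le> (\<Sum>i\<in>J. \<Sum>j\<in>J. a i * a j * f (u i - u j))" .
  qed
qed

section \<open>Positive-definite functions on the line\<close>

lemma positive_definite_sum_pos:
  assumes K: "positive_definite K" and "finite I" and inj: "inj_on z I"
    and nz: "\<exists>i\<in>I. a i \<noteq> 0"
  shows "0 < (\<Sum>i\<in>I. \<Sum>j\<in>I. a i * a j * K (z i) (z j))"
proof -
  obtain e where e: "bij_betw e {..<card I} I"
    using ex_bij_betw_nat_finite[OF \<open>finite I\<close>] by (auto simp: atLeast0LessThan)
  have "inj_on (z \<circ> e) {..<card I}"
    using e inj by (simp add: bij_betw_def comp_inj_on)
  moreover have "\<exists>k<card I. (a \<circ> e) k \<noteq> 0"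
  proof -
    obtain i where "i \<in> I" "a i \<noteq> 0" using nz by blast
    moreover from this obtain k where "k < card I" "e k = i"
      using bij_betw_imp_surj_on[OF e] by (metis imageE lessThan_iff)
    ultimately show ?thesis by auto
  qed
  ultimately have "0 < (\<Sum>k<card I. \<Sum>l<card I. (a \<circ> e) k * (a \<circ> e) l * K ((z \<circ> e) k) ((z \<circ> e) l))"
    using K unfolding positive_definite_def by blast
  also have "\<dots> = (\<Sum>i\<in>I. \<Sum>j\<in>I. a i * a j * K (z i) (z j))"
    by (simp add: sum.reindex_bij_betw[OF e, symmetric])
  finally show ?thesis .
qed

lemma positive_definite_translation_pos:
  fixes f :: "real \<Rightarrow> real"
  assumes "positive_definite (\<lambda>x y. f (x - y))" and "finite A" and "\<exists>x\<in>A. a x \<noteq> 0"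
  shows "0 < (\<Sum>x\<in>A. \<Sum>y\<in>A. a x * a y * f (x - y))"
  using positive_definite_sum_pos[OF assms(1,2), of "\<lambda>x. x" a] assms(3) by simp

context
  fixes f :: "real \<Rightarrow> real"
  assumes sym: "symmetric_kernel (\<lambda>x y. f (x - y))"
    and pd: "positive_definite (\<lambda>x y. f (x - y))"
begin

lemma translation_kernel_even: "f (- x) = f x"
  using sym unfolding symmetric_kernel_def by (metis diff_0 diff_zero)

lemma translation_kernel_minus: "f (x - y) = f (y - x)"
  using translation_kernel_even[of "x - y"] by simp

lemma translation_kernel_0_pos: "0 < f 0"
  using positive_definite_translation_pos[OF pd, of "{0}" "\<lambda>_. 1"] by simp

lemma translation_kernel_abs_le: "\<bar>f x\<bar> \<le> f 0"
proof (cases "x = 0")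
  case True
  then show ?thesis using translation_kernel_0_pos by simp
next
  case False
  have "0 < (\<Sum>s\<in>{0, x}. \<Sum>t\<in>{0, x}. 1 * 1 * f (s - t))"
    by (rule positive_definite_translation_pos[OF pd]) auto
  moreover have "0 < (\<Sum>s\<in>{0, x}. \<Sum>t\<in>{0, x}.
      (if s = 0 then 1 else - 1) * (if t = 0 then 1 else - 1) * f (s - t))"
    by (rule positive_definite_translation_pos[OF pd]) auto
  ultimately show ?thesis
    using False translation_kernel_even by (simp split: if_splits)
qed

text \<open>
  Krein's inequality. It is the nonnegativity of the quadratic form at the points \<open>0, x, y\<close> with
  weights \<open>b, 1, -1\<close>, minimised over \<open>b\<close>. The definition of positive definiteness speaks of distinct
  points only, so coinciding points are treated separately.
\<close>

lemma translation_kernel_increment: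
  "(f x - f y)\<^sup>2 \<le> 2 * f 0 * (f 0 - f (x - y))"
proof (cases "x = 0 \<or> y = 0 \<or> x = y")
  case True
  have *: "(f t - f 0)\<^sup>2 \<le> 2 * f 0 * (f 0 - f t)" for t
  proof -
    have "(f 0 - f t) * (f 0 - f t) \<le> 2 * f 0 * (f 0 - f t)"
      using translation_kernel_abs_le[of t] by (intro mult_right_mono) auto
    then show ?thesis by (simp add: power2_eq_square algebra_simps)
  qed
  from True *[of x] *[of y] show ?thesis
    using translation_kernel_even[of y] by (auto simp: power2_commute)
next
  case False
  define b where "b = - (f x - f y) / f 0"
  have f0: "f 0 > 0" by (rule translation_kernel_0_pos)
  define a where "a t = (if t = 0 then b else if t = x then 1 else - 1)" for t
  have "0 < (\<Sum>s\<in>{0, x, y}. \<Sum>t\<in>{0, x, y}. a s * a t * f (s - t))"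
    using False by (intro positive_definite_translation_pos[OF pd]) (auto simp: a_def)
  also have "\<dots> = b\<^sup>2 * f 0 + 2 * b * (f x - f y) + 2 * f 0 - 2 * f (x - y)"
    using False translation_kernel_even[of x] translation_kernel_even[of y]
      translation_kernel_minus[of y x]
    by (simp add: a_def power2_eq_square algebra_simps)
  also have "b\<^sup>2 * f 0 + 2 * b * (f x - f y) = - ((f x - f y)\<^sup>2 / f 0)"
    using f0 by (simp add: b_def power2_eq_square field_simps)
  finally have "(f x - f y)\<^sup>2 / f 0 < 2 * (f 0 - f (x - y))" by simp
  then show ?thesis using f0 by (simp add: field_simps)
qed

lemma translation_kernel_uniformly_continuous:
  assumes "isCont f 0"
  shows "uniformly_continuous_on UNIV f"
  unfolding uniformly_continuous_on_def
proof (intro allI impI)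
  fix e :: real assume e: "e > 0"
  have f0: "f 0 > 0" by (rule translation_kernel_0_pos)
  then have "e\<^sup>2 / (2 * f 0) > 0" using e by simp
  then obtain d where d: "d > 0" "\<And>t. dist t 0 < d \<Longrightarrow> dist (f t) (f 0) < e\<^sup>2 / (2 * f 0)"
    using assms unfolding continuous_at_eps_delta by blast
  have "dist (f x') (f x) < e" if "dist x' x < d" for x x'
  proof -
    have "f 0 - f (x' - x) < e\<^sup>2 / (2 * f 0)"
      using d(2)[of "x' - x"] that by (simp add: dist_real_def abs_less_iff)
    then have "2 * f 0 * (f 0 - f (x' - x)) < e\<^sup>2"
      using f0 by (simp add: field_simps)
    with translation_kernel_increment[of x' x] have "\<bar>f x' - f x\<bar>\<^sup>2 < e\<^sup>2" by simp
    then show ?thesis using e by (simp only: dist_real_def power2_less_imp_less less_imp_le)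
  qed
  then show "\<exists>d>0. \<forall>x\<in>UNIV. \<forall>x'\<in>UNIV. dist x' x < d \<longrightarrow> dist (f x') (f x) < e"
    using d(1) by blast
qed

end

text \<open>
  By uniform continuity a value of \<open>f\<close> at \<open>x\<close> is almost attained on a whole interval of fixed length
  \<open>d\<close> next to \<open>x\<close>, and the integral of \<open>\<bar>f\<bar>\<close> over such intervals vanishes as they move to infinity.
\<close>

lemma uniformly_continuous_integrable_tendsto_0:
  fixes f :: "real \<Rightarrow> real"
  assumes uc: "uniformly_continuous_on UNIV f" and int: "integrable lborel f"
  shows "(f \<longlongrightarrow> 0) at_top"
proof (rule tendstoI)
  fix e :: real assume "e > 0"
  then obtain d where d: "d > 0" "\<And>x y. dist y x < d \<Longrightarrow> dist (f y) (f x) < e / 2"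
    using uc unfolding uniformly_continuous_on_def by (metis UNIV_I half_gt_zero)
  let ?A = "\<lambda>x. \<integral>y. indicator {x..<x + d} y * \<bar>f y\<bar> \<partial>lborel"
  have [measurable]: "f \<in> borel_measurable borel" using int by auto
  have "(?A \<longlongrightarrow> (\<integral>y. 0 \<partial>(lborel :: real measure))) at_top"
  proof (rule integral_dominated_convergence_at_top[where w = "\<lambda>y. \<bar>f y\<bar>"])
    show "AE y in lborel. ((\<lambda>x. indicator {x..<x + d} y * \<bar>f y\<bar>) \<longlongrightarrow> 0) at_top"
    proof (rule AE_I2, rule tendsto_eventually)
      show "\<forall>\<^sub>F x in at_top. indicator {x..<x + d} y * \<bar>f y\<bar> = 0" for y :: real
        using eventually_gt_at_top[of y] by eventually_elim auto
    qed
  qed (use int in \<open>auto simp: indicator_def\<close>)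
  then have "\<forall>\<^sub>F x in at_top. ?A x < d * (e / 2)"
    using d(1) \<open>e > 0\<close> by (intro order_tendstoD) auto
  then show "\<forall>\<^sub>F x in at_top. dist (f x) 0 < e"
  proof eventually_elim
    case (elim x)
    have int1: "integrable lborel (\<lambda>y. indicator {x..<x + d} y * \<bar>f y\<bar>)"
      using int by (intro integrable_mult_indicator[where 'b = real, simplified]) auto
    have int2: "integrable lborel (\<lambda>y. indicator {x..<x + d} y * c)" for c :: real
      using d(1) by (intro integrable_mult_left integrable_real_indicator) auto
    have "d * \<bar>f x\<bar> = (\<integral>y. indicator {x..<x + d} y * \<bar>f x\<bar> \<partial>lborel)"
      using d(1) by simp
    also have "\<dots> \<le> (\<integral>y. indicator {x..<x + d} y * \<bar>f y\<bar> + indicator {x..<x + d} y * (e / 2) \<partial>lborel)"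
    proof (rule integral_mono[OF int2 Bochner_Integration.integrable_add[OF int1 int2]])
      fix y
      show "indicator {x..<x + d} y * \<bar>f x\<bar>
          \<le> indicator {x..<x + d} y * \<bar>f y\<bar> + indicator {x..<x + d} y * (e / 2)"
      proof (cases "y \<in> {x..<x + d}")
        case True
        then have "\<bar>f y - f x\<bar> < e / 2" using d(2)[of y x] by (simp add: dist_real_def)
        then have "\<bar>f x\<bar> \<le> \<bar>f y\<bar> + e / 2" by linarith
        then show ?thesis using True by simp
      qed simp
    qed
    also have "\<dots> = ?A x + d * (e / 2)"
      using d(1) by (subst Bochner_Integration.integral_add[OF int1 int2]) simp
    finally have "d * \<bar>f x\<bar> < d * e" using elim by (simp add: field_simps)
    then show ?case using d(1) by simp
  qed
qed

section \<open>Determinants and quadratic forms\<close>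

lemma tendsto_det:
  fixes A :: "'a \<Rightarrow> real ^ 'n ^ 'n"
  assumes "\<And>i j. ((\<lambda>t. A t $ i $ j) \<longlongrightarrow> L $ i $ j) F"
  shows "((\<lambda>t. det (A t)) \<longlongrightarrow> det L) F"
  unfolding det_def by (intro tendsto_intros assms)

text \<open>
  All matrices on the segment from the identity to \<open>A\<close> have a positive quadratic form, hence
  are invertible; so the determinant cannot change sign along it.
\<close>

lemma det_pos_if_positive_form:
  fixes A :: "real ^ 'n ^ 'n"
  assumes A: "\<And>v. v \<noteq> 0 \<Longrightarrow> 0 < v \<bullet> (A *v v)"
  shows "0 < det A"
proof (rule ccontr)
  assume "\<not> 0 < det A"
  define M where "M t = (1 - t) *\<^sub>R mat 1 + t *\<^sub>R A" for t :: real
  have "continuous_on {0..1} (\<lambda>t. det (M t))"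
    unfolding continuous_on_def M_def by (intro ballI tendsto_det) (auto intro!: tendsto_eq_intros)
  moreover have "det (M 0) = 1" "det (M 1) = det A" by (simp_all add: M_def)
  ultimately obtain t where t: "0 \<le> t" "t \<le> 1" "det (M t) = 0"
    using IVT2'[of "\<lambda>t. det (M t)" 1 0 0] \<open>\<not> 0 < det A\<close> by auto
  then have "\<not> invertible (M t)" by (simp add: invertible_det_nz)
  then obtain v where v: "M t *v v = 0" "v \<noteq> 0"
    by (metis invertible_left_inverse matrix_left_invertible_ker)
  have "0 = v \<bullet> (M t *v v)" using v by simp
  also have "\<dots> = (1 - t) * (v \<bullet> v) + t * (v \<bullet> (A *v v))"
    by (simp add: M_def matrix_vector_mult_add_rdistrib scaleR_matrix_vector_assoc[symmetric] inner_add_right)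
  finally have "(1 - t) * (v \<bullet> v) + t * (v \<bullet> (A *v v)) = 0" by simp
  moreover have "0 \<le> (1 - t) * (v \<bullet> v)" using t by simp
  moreover have "0 < t * (v \<bullet> (A *v v))" if "t \<noteq> 0" using that t A[OF v(2)] by simp
  ultimately show False using v(2) by (cases "t = 0") auto
qed

lemma inner_matrix_vector_mult_sum:
  fixes A :: "real ^ 'n ^ 'n"
  shows "v \<bullet> (A *v v) = (\<Sum>i\<in>UNIV. \<Sum>j\<in>UNIV. v $ i * v $ j * A $ i $ j)"
  by (simp add: inner_vec_def matrix_vector_mult_def sum_distrib_left mult_ac)

text \<open>
  With \<open>A b = (c, \<dots>, c)\<close> and \<open>S = \<Sum>i. b\<^sub>i\<close> the quantity to estimate is \<open>c * S = b\<^sup>T A b\<close>, which is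
  at least \<open>C * S\<^sup>2\<close>; this confines \<open>S\<close>. Thus an upper bound for the inverse on constant vectors needs
  coercivity of \<open>A\<close> only through the sum of the coordinates.
\<close>

lemma inner_matrix_inv_const_bounds:
  fixes A :: "real ^ 'n ^ 'n"
  assumes pos: "\<And>v. v \<noteq> 0 \<Longrightarrow> 0 < v \<bullet> (A *v v)"
    and C: "C > 0" "\<And>v. C * (\<Sum>i\<in>UNIV. v $ i)\<^sup>2 \<le> v \<bullet> (A *v v)"
  shows "0 \<le> (\<chi> i. c) \<bullet> (matrix_inv A *v (\<chi> i. c))"
    and "(\<chi> i. c) \<bullet> (matrix_inv A *v (\<chi> i. c)) \<le> c\<^sup>2 / C"
proof -
  define b where "b = matrix_inv A *v (\<chi> i. c)"
  let ?S = "\<Sum>i\<in>UNIV. b $ i"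
  have "invertible A"
    using det_pos_if_positive_form[OF pos] by (simp add: invertible_det_nz)
  then have "A ** matrix_inv A = mat 1"
    unfolding matrix_inv_def invertible_def by (rule someI2_ex) simp
  then have "A *v b = (\<chi> i. c)"
    by (simp add: b_def matrix_vector_mul_assoc)
  then have b: "(\<chi> i. c) \<bullet> b = b \<bullet> (A *v b)" by (simp add: inner_commute)
  have S: "(\<chi> i. c) \<bullet> b = c * ?S" by (simp add: inner_vec_def sum_distrib_left)
  have nonneg: "0 \<le> c * ?S"
    using pos[of b] unfolding S[symmetric] b by (cases "b = 0") auto
  have "C * (c * ?S)\<^sup>2 = c\<^sup>2 * (C * ?S\<^sup>2)" by (simp add: power_mult_distrib)
  also have "\<dots> \<le> c\<^sup>2 * (c * ?S)"
    using C(2)[of b] unfolding S[symmetric] b by (intro mult_left_mono) auto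
  finally have "(C * (c * ?S)) * (c * ?S) \<le> c\<^sup>2 * (c * ?S)"
    by (simp only: power2_eq_square mult.assoc)
  then have "C * (c * ?S) \<le> c\<^sup>2" if "0 < c * ?S"
    using that by (rule mult_right_le_imp_le)
  moreover have "C * (c * ?S) \<le> c\<^sup>2" if "c * ?S = 0"
    unfolding that by simp
  ultimately have "C * (c * ?S) \<le> c\<^sup>2"
    using nonneg by argo
  then have "c * ?S \<le> c\<^sup>2 / C" using C(1) by (simp add: field_simps)
  with nonneg have "0 \<le> (\<chi> i. c) \<bullet> b" "(\<chi> i. c) \<bullet> b \<le> c\<^sup>2 / C"
    unfolding S by auto
  then show "0 \<le> (\<chi> i. c) \<bullet> (matrix_inv A *v (\<chi> i. c))"
    and "(\<chi> i. c) \<bullet> (matrix_inv A *v (\<chi> i. c)) \<le> c\<^sup>2 / C"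
    unfolding b_def by auto
qed

lemma continuous_pos_limit_pos_bounded_below:
  fixes g :: "real \<Rightarrow> real"
  assumes cont: "continuous_on {t0..} g" and pos: "\<And>t. t \<ge> t0 \<Longrightarrow> 0 < g t"
    and lim: "(g \<longlongrightarrow> l) at_top" and l: "0 < l"
  obtains m where "0 < m" "\<And>t. t \<ge> t0 \<Longrightarrow> m \<le> g t"
proof -
  have "\<forall>\<^sub>F t in at_top. l / 2 < g t" using l by (intro order_tendstoD[OF lim]) auto
  then obtain T where T: "\<And>t. t \<ge> T \<Longrightarrow> l / 2 < g t" by (auto simp: eventually_at_top_linorder)
  let ?I = "{t0..max t0 T}"
  obtain x where x: "x \<in> ?I" "\<And>y. y \<in> ?I \<Longrightarrow> g x \<le> g y"
  proof -
    have "continuous_on ?I g" using cont by (rule continuous_on_subset) auto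
    then show ?thesis using continuous_attains_inf[of ?I g] that by fastforce
  qed
  show ?thesis
  proof
    show "0 < min (l / 2) (g x)" using l pos[of x] x(1) by auto
    show "min (l / 2) (g x) \<le> g t" if "t \<ge> t0" for t
      using T[of t] x(2)[of t] that by (cases "t \<le> T") (auto simp: min_le_iff_disj less_imp_le)
  qed
qed

section \<open>The likelihood for constant residuals\<close>

theorem theorem5p4:
  fixes \<Phi> m :: "real \<Rightarrow> real" and X Y :: "real ^ 'n"
  assumes "symmetric_kernel (\<lambda>x y. \<Phi> (x - y))"
    and "positive_definite (\<lambda>x y. \<Phi> (x - y))"
    and "integrable lebesgue \<Phi>"
    and "infinitely_differentiable_near \<Phi> 0"
    and "\<forall>k. odd k \<longrightarrow> (deriv ^^ k) \<Phi> 0 = 0"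
    and "\<forall>\<xi>. fourier_transform \<Phi> \<xi> \<in> \<real> \<and> Re (fourier_transform \<Phi> \<xi>) > 0"
    and "CARD('n) \<ge> 2"
    and "inj (\<lambda>i. X $ i)"
    and "mean_constant m X Y"
  shows "filterlim (neg_log_likelihood \<Phi> m X Y) at_bot at_top
       \<and> argmin_at_infinity (neg_log_likelihood \<Phi> m X Y)"
proof -
  note sym = assms(1) and pd = assms(2) and card2 = assms(7) and injX = assms(8)
  let ?n = "CARD('n)" and ?l = "neg_log_likelihood \<Phi> m X Y"
  have "\<Phi> field_differentiable at 0"
    using assms(4) unfolding infinitely_differentiable_near_def by (metis funpow_0)
  then have uc: "uniformly_continuous_on UNIV \<Phi>"
    by (intro translation_kernel_uniformly_continuous[OF sym pd]
        field_differentiable_imp_continuous_at)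
  then have cont: "continuous_on UNIV \<Phi>" by (rule uniformly_continuous_imp_continuous)
  then have "\<Phi> \<in> borel_measurable lborel" by (simp add: borel_measurable_continuous_onI)
  then have int: "integrable lborel \<Phi>"
    using assms(3) by (simp add: integrable_completion)
  have sin0: "(\<integral>x. \<Phi> x * sin (\<omega> * x) \<partial>lborel) = 0"
    and Fpos: "0 < cosine_transform \<Phi> \<omega>" for \<omega>
    using assms(6)[rule_format, of \<omega>] fourier_transform_cos_sin[OF int, of \<omega>]
    by (simp_all add: complex_is_Real_iff)

  have "\<exists>C>0. \<forall>J (a :: 'n \<Rightarrow> real) u. finite J \<longrightarrow> card J = ?n \<longrightarrow>
      C * (sum a J)\<^sup>2 \<le> (\<Sum>i\<in>J. \<Sum>j\<in>J. a i * a j * \<Phi> (u i - u j))"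
    by (rule quadratic_form_ge_sum_squared[OF cont translation_kernel_abs_le[OF sym pd] int sin0 Fpos])
       simp
  then obtain C where C: "C > 0"
    "\<forall>J (a :: 'n \<Rightarrow> real) u. finite J \<longrightarrow> card J = ?n \<longrightarrow>
      C * (sum a J)\<^sup>2 \<le> (\<Sum>i\<in>J. \<Sum>j\<in>J. a i * a j * \<Phi> (u i - u j))"
    by blast

  define M :: "real \<Rightarrow> real ^ 'n ^ 'n" where "M t = (\<chi> i j. \<Phi> (t * (X $ i - X $ j)))" for t
  have kernel_M: "kernel_matrix (scaled_kernel \<Phi> l) X = M (1 / l)" for l
    by (simp add: M_def kernel_matrix_def scaled_kernel_def)
  have form: "v \<bullet> (M t *v v) = (\<Sum>i\<in>UNIV. \<Sum>j\<in>UNIV. v $ i * v $ j * \<Phi> (t * X $ i - t * X $ j))" for t v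
    by (simp add: inner_matrix_vector_mult_sum M_def right_diff_distrib)
  have form_pos: "0 < v \<bullet> (M t *v v)" if "t > 0" "v \<noteq> 0" for t v
    unfolding form using that injX
    by (intro positive_definite_sum_pos[OF pd, where z = "\<lambda>i. t * X $ i"])
       (auto simp: inj_on_def vec_eq_iff)
  have form_ge: "C * (\<Sum>i\<in>UNIV. v $ i)\<^sup>2 \<le> v \<bullet> (M t *v v)" for t v
    unfolding form by (rule C(2)[rule_format]) simp_all
  define g where "g t = det (M t)" for t
  have g_pos: "g t > 0" if "t > 0" for t
    unfolding g_def using form_pos[OF that] by (rule det_pos_if_positive_form)
  have g_cont: "(g \<longlongrightarrow> g t) (at t)" for t
  proof -
    have "((\<lambda>s. \<Phi> (s * (X $ i - X $ j))) \<longlongrightarrow> \<Phi> (t * (X $ i - X $ j))) (at t)" for i j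
      using cont by (intro continuous_on_tendsto_compose[OF cont] tendsto_intros) auto
    then show ?thesis unfolding g_def by (intro tendsto_det) (simp add: M_def)
  qed

  obtain c where c: "residual m X Y = (\<chi> i. c)"
    using assms(9) unfolding mean_constant_def by blast
  define q where "q l = (\<chi> i. c) \<bullet> (matrix_inv (M (1 / l)) *v (\<chi> i. c))" for l
  have l_eq: "?l l = q l + ln (g (1 / l))" for l
    by (simp add: neg_log_likelihood_def q_def g_def c kernel_M)
  have q: "0 \<le> q l" "q l \<le> c\<^sup>2 / C" if "l > 0" for l
  proof -
    have "1 / l > 0" using that by simp
    note bounds = inner_matrix_inv_const_bounds[OF form_pos[OF this] C(1) form_ge]
    show "0 \<le> q l" "q l \<le> c\<^sup>2 / C"
      unfolding q_def by (rule bounds(1), assumption, rule bounds(2), assumption)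
  qed

  have lim: "filterlim ?l at_bot at_top"
  proof -
    \<comment> \<open>\<open>M 0\<close> has two equal rows.\<close>
    have "(UNIV :: 'n set) \<noteq> {i}" for i
    proof
      assume "(UNIV :: 'n set) = {i}"
      then have "?n = card {i}" by (rule arg_cong)
      then show False using card2 by simp
    qed
    then obtain i j :: 'n where "i \<noteq> j" by blast
    then have "g 0 = 0"
      unfolding g_def by (intro det_identical_rows[of i j]) (auto simp: M_def row_def)
    moreover have "((\<lambda>l. g (1 / l)) \<longlongrightarrow> g 0) at_top"
    proof (rule filterlim_compose[OF g_cont])
      show "filterlim (\<lambda>l::real. 1 / l) (at 0) at_top"
        by (rule filterlim_mono[OF filterlim_inverse_at_right_top at_le order_refl,
              unfolded inverse_eq_divide]) simp
    qed
    moreover have "\<forall>\<^sub>F l in at_top. 0 < g (1 / l)"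
      using eventually_gt_at_top[of 0] by eventually_elim (simp add: g_pos)
    ultimately have "filterlim (\<lambda>l. g (1 / l)) (at_right 0) at_top"
      by (auto simp: filterlim_at elim!: eventually_mono)
    then have ln_lim: "filterlim (\<lambda>l. ln (g (1 / l))) at_bot at_top"
      by (rule filterlim_compose[OF ln_at_0])
    show ?thesis
      unfolding filterlim_at_bot
    proof
      fix Z
      have "\<forall>\<^sub>F l in at_top. ln (g (1 / l)) \<le> Z - c\<^sup>2 / C"
        using ln_lim by (simp add: filterlim_at_bot)
      then show "\<forall>\<^sub>F l in at_top. ?l l \<le> Z"
        using eventually_gt_at_top[of 0]
      proof eventually_elim
        case (elim l)
        then show ?case using q(2)[of l] l_eq[of l] by simp
      qed
    qed
  qed

  have bounded_below: "\<exists>B. \<forall>l. 0 < l \<and> l \<le> L \<longrightarrow> B \<le> ?l l" if "L > 0" for L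
  proof -
    \<comment> \<open>As the length scale tends to \<open>0\<close>, the kernel matrix tends to \<open>\<Phi> 0\<close> times the identity.\<close>
    have decay: "((\<lambda>t. \<Phi> (t * x)) \<longlongrightarrow> 0) at_top" if "x \<noteq> 0" for x
    proof -
      have "filterlim (\<lambda>t. t * \<bar>x\<bar>) at_top at_top"
        by (rule filterlim_at_top_mult_tendsto_pos[OF tendsto_const _ filterlim_ident]) (use that in simp)
      from filterlim_compose[OF uniformly_continuous_integrable_tendsto_0[OF uc int] this]
      have "((\<lambda>t. \<Phi> (t * \<bar>x\<bar>)) \<longlongrightarrow> 0) at_top" .
      moreover have "\<Phi> (t * \<bar>x\<bar>) = \<Phi> (t * x)" for t
        using translation_kernel_even[OF sym pd, of "t * x"] by (auto simp: abs_if)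
      ultimately show ?thesis by simp
    qed
    define D :: "real ^ 'n ^ 'n" where "D = (\<chi> i j. if i = j then \<Phi> 0 else 0)"
    have "(g \<longlongrightarrow> det D) at_top"
      unfolding g_def
    proof (rule tendsto_det)
      show "((\<lambda>t. M t $ i $ j) \<longlongrightarrow> D $ i $ j) at_top" for i j
        using decay[of "X $ i - X $ j"] injX by (auto simp: M_def D_def inj_def)
    qed
    moreover have "det D > 0"
      using translation_kernel_0_pos[OF sym pd]
      by (subst det_diagonal) (auto simp: D_def intro!: prod_pos)
    moreover have "continuous_on {1 / L..} g"
      unfolding continuous_on_def using g_cont tendsto_within_subset by blast
    ultimately obtain b where b: "0 < b" "\<And>t. t \<ge> 1 / L \<Longrightarrow> b \<le> g t"
      using continuous_pos_limit_pos_bounded_below[of "1 / L" g "det D"] g_pos \<open>L > 0\<close>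
      by (metis divide_pos_pos less_le_trans zero_less_one)
    have "ln b \<le> ?l l" if "0 < l" "l \<le> L" for l
    proof -
      have "1 / l \<ge> 1 / L" using that by (simp add: frac_le)
      then have "ln b \<le> ln (g (1 / l))" using b by (simp add: order_less_le_trans)
      then show ?thesis using q(1)[OF that(1)] by (simp add: l_eq)
    qed
    then show ?thesis by blast
  qed

  have "argmin_at_infinity ?l"
    unfolding argmin_at_infinity_def
  proof (intro allI impI)
    fix s :: "nat \<Rightarrow> real"
    assume s: "\<forall>k. 0 < s k" and min: "(\<lambda>k. ereal (?l (s k))) \<longlonglongrightarrow> (INF l\<in>{0<..}. ereal (?l l))"
    \<comment> \<open>The infimum is \<open>-\<infinity>\<close>, so a minimising sequence leaves every interval \<open>(0, L]\<close>.\<close>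
    have below: "(INF l\<in>{0<..}. ereal (?l l)) < ereal B" for B
    proof -
      have "\<forall>\<^sub>F l in at_top. ?l l < B \<and> 0 < l"
        using lim eventually_gt_at_top[of 0] by (auto simp: filterlim_at_bot_dense eventually_conj_iff)
      then obtain l where "?l l < B" "0 < l"
        using eventually_happens'[OF trivial_limit_at_top_linorder] by blast
      then show ?thesis unfolding INF_less_iff by (intro bexI[of _ l]) simp_all
    qed
    show "filterlim s at_top sequentially"
      unfolding filterlim_at_top_gt[where c = 0]
    proof (intro allI impI)
      fix L :: real assume "L > 0"
      then obtain B where B: "\<And>l. 0 < l \<Longrightarrow> l \<le> L \<Longrightarrow> B \<le> ?l l" using bounded_below by blast
      have "\<forall>\<^sub>F k in sequentially. ereal (?l (s k)) < ereal B"
        using order_tendstoD(2)[OF min below] .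
      then show "\<forall>\<^sub>F k in sequentially. L \<le> s k"
      proof eventually_elim
        case (elim k)
        then have "\<not> B \<le> ?l (s k)" by simp
        then have "\<not> s k \<le> L" using B[of "s k"] s by blast
        then show ?case by simp
      qed
    qed
  qed
  with lim show ?thesis ..
qed

end
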